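(* Let $a,b$ be integers with $a^2+4b\neq 0$, let $\alpha,\beta=\frac{a\pm\sqrt{a^2+4b}}{2}$, and define $u_n=\frac{\alpha^n-\beta^n}{\alpha-\beta}$, $v_n=\alpha^n+\beta^n$ for $n\ge 0$ (so $u_0=0$, $u_1=1$, $v_0=2$, $v_1=a$, and both satisfy $w_n=aw_{n-1}+bw_{n-2}$ for $n\ge2$). Let $r\ge 1$ and $n\ge 0$ be integers. If $r$ is odd, then $$ \sum_{\substack{k_1+\cdots+k_r=n\\ k_1,\dots,k_r\ge 1}}\binom{n}{k_1,\dots,k_r}u_{k_1}\cdots u_{k_r} =\frac{1}{(\sqrt{a^2+4 b})^{r-1}}\sum_{k=0}^n\binom{n}{k}\sum_{j=0}^{\frac{r-1}{2}}(-1)^j\binom{r}{j}(a j)^{n-k}(r-2 j)^k u_k $$ and $$ \sum_{\substack{k_1+\cdots+k_r=n\\ k_1,\dots,k_r\ge 0}}\binom{n}{k_1,\dots,k_r}v_{k_1}\cdots v_{k_r} =\sum_{k=0}^n\binom{n}{k}\sum_{j=0}^{\frac{r-1}{2}}\binom{r}{j}(a j)^{n-k}(r-2 j)^k v_k\,. $$ If $r$ is even, then $$ \sum_{\substack{k_1+\cdots+k_r=n\\ k_1,\dots,k_r\ge 1}}\binom{n}{k_1,\dots,k_r}u_{k_1}\cdots u_{k_r} =\frac{1}{(\sqrt{a^2+4 b})^{r}}\left(\sum_{k=0}^n\binom{n}{k}\sum_{j=0}^{\frac{r}{2}-1}(-1)^j\binom{r}{j}(a j)^{n-k}(r-2 j)^k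 v_k +(-1)^{\frac{r}{2}}\binom{r}{\frac{r}{2}}\left(\frac{a r}{2}\right)^n\right) $$ and $$ \sum_{\substack{k_1+\cdots+k_r=n\\ k_1,\dots,k_r\ge 0}}\binom{n}{k_1,\dots,k_r}v_{k_1}\cdots v_{k_r} =\sum_{k=0}^n\binom{n}{k}\sum_{j=0}^{\frac{r}{2}-1}\binom{r}{j}(a j)^{n-k}(r-2 j)^k v_k +\binom{r}{\frac{r}{2}}\left(\frac{a r}{2}\right)^n\,. $$
   Context: $\binom{n}{k_1,\dots,k_r}=\frac{n!}{k_1!\cdots k_r!}$ is the multinomial coefficient, and the sums on the left are over ordered $r$-tuples of integers with the indicated bounds summing to $n$. The convention $0^0=1$ is used (relevant for the term $j=0$). Since the exponents of $\sqrt{a^2+4b}$ appearing are even ($r-1$ for odd $r$, $r$ for even $r$), these powers equal $(a^2+4b)^{(r-1)/2}$ and $(a^2+4b)^{r/2}$ respectively. *)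

theory Defs
  imports Complex_Main
begin

definition lucas_root :: "int \<Rightarrow> int \<Rightarrow> complex" where
  "lucas_root a b = csqrt (of_int (a\<^sup>2 + 4 * b))"

definition lucas_alpha :: "int \<Rightarrow> int \<Rightarrow> complex" where
  "lucas_alpha a b = (of_int a + lucas_root a b) / 2"

definition lucas_beta :: "int \<Rightarrow> int \<Rightarrow> complex" where
  "lucas_beta a b = (of_int a - lucas_root a b) / 2"

definition lucas_u :: "int \<Rightarrow> int \<Rightarrow> nat \<Rightarrow> complex" where
  "lucas_u a b n =
     (lucas_alpha a b ^ n - lucas_beta a b ^ n) / (lucas_alpha a b - lucas_beta a b)"

definition lucas_v :: "int \<Rightarrow> int \<Rightarrow> nat \<Rightarrow> complex" where
  "lucas_v a b n = lucas_alpha a b ^ n + lucas_beta a b ^ n"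

definition multinomial :: "nat \<Rightarrow> nat list \<Rightarrow> complex" where
  "multinomial n ks = fact n / prod_list (map fact ks)"

text \<open>Ordered \<open>r\<close>-tuples with entries at least \<open>m\<close> and sum \<open>n\<close>, as lists of length \<open>r\<close>.\<close>

definition sum_tuples :: "nat \<Rightarrow> nat \<Rightarrow> nat \<Rightarrow> nat list set" where
  "sum_tuples m r n = {ks. length ks = r \<and> (\<forall>k\<in>set ks. m \<le> k) \<and> sum_list ks = n}"

lemma finite_sum_tuples: "finite (sum_tuples m r n)"
proof (rule finite_subset)
  show "sum_tuples m r n \<subseteq> {ks. set ks \<subseteq> {..n} \<and> length ks = r}"
    by (auto simp: sum_tuples_def intro: member_le_sum_list)
  show "finite {ks. set ks \<subseteq> {..n} \<and> length ks = r}"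
    by (rule finite_lists_length_eq) simp
qed

lemma lucas_root_squared: "(lucas_root a b)\<^sup>2 = of_int (a\<^sup>2 + 4 * b)"
  by (simp add: lucas_root_def)

lemma lucas_alpha_minus_beta: "lucas_alpha a b - lucas_beta a b = lucas_root a b"
  by (simp add: lucas_alpha_def lucas_beta_def field_simps)

lemma lucas_alpha_squared:
  "(lucas_alpha a b)\<^sup>2 = of_int a * lucas_alpha a b + of_int b"
  using lucas_root_squared[of a b]
  by (simp add: lucas_alpha_def field_simps power2_eq_square)

lemma lucas_beta_squared:
  "(lucas_beta a b)\<^sup>2 = of_int a * lucas_beta a b + of_int b"
  using lucas_root_squared[of a b]
  by (simp add: lucas_beta_def field_simps power2_eq_square)

lemma lucas_u_0: "lucas_u a b 0 = 0"
  by (simp add: lucas_u_def)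

lemma lucas_u_1:
  assumes "a\<^sup>2 + 4 * b \<noteq> 0"
  shows "lucas_u a b 1 = 1"
proof -
  have "(of_int (a\<^sup>2 + 4 * b) :: complex) \<noteq> 0"
    using assms of_int_eq_0_iff by blast
  then have "lucas_root a b \<noteq> 0"
    using lucas_root_squared[of a b] by auto
  then show ?thesis
    by (simp add: lucas_u_def lucas_alpha_minus_beta)
qed

lemma lucas_v_0: "lucas_v a b 0 = 2"
  by (simp add: lucas_v_def)

lemma lucas_v_1: "lucas_v a b 1 = of_int a"
  by (simp add: lucas_v_def lucas_alpha_def lucas_beta_def field_simps)

lemma lucas_power_rec:
  fixes x :: complex
  assumes "x\<^sup>2 = of_int a * x + of_int b"
  shows "x ^ (n + 2) = of_int a * x ^ (n + 1) + of_int b * x ^ n"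
proof -
  have "x ^ (n + 2) = x ^ n * x\<^sup>2"
    by (simp only: power_add)
  then show ?thesis
    by (simp add: assms algebra_simps)
qed

lemma lucas_u_rec:
  "lucas_u a b (n + 2) = of_int a * lucas_u a b (n + 1) + of_int b * lucas_u a b n"
  unfolding lucas_u_def
  using lucas_power_rec[OF lucas_alpha_squared, of a b n]
    lucas_power_rec[OF lucas_beta_squared, of a b n]
  by (simp add: diff_divide_distrib add_divide_distrib algebra_simps)

lemma lucas_v_rec:
  "lucas_v a b (n + 2) = of_int a * lucas_v a b (n + 1) + of_int b * lucas_v a b n"
  unfolding lucas_v_def
  using lucas_power_rec[OF lucas_alpha_squared, of a b n]
    lucas_power_rec[OF lucas_beta_squared, of a b n]
  by (simp add: algebra_simps)

end

theory Submission
  imports Defs "HOL-Computational_Algebra.Formal_Power_Series"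
begin

text \<open>
  The left-hand sides are \<open>n!\<close> times the coefficients of the \<open>r\<close>-th powers of the exponential
  generating functions \<open>(exp (\<alpha>x) - exp (\<beta>x)) / (\<alpha> - \<beta>)\<close> and \<open>exp (\<alpha>x) + exp (\<beta>x)\<close>. The binomial
  theorem expands such a power into terms \<open>exp (((r-j)\<alpha> + j\<beta>)x)\<close>. Since \<open>\<alpha> + \<beta> = a\<close>, the exponents
  for \<open>j\<close> and \<open>r-j\<close> are \<open>aj + (r-2j)\<alpha>\<close> and \<open>aj + (r-2j)\<beta>\<close>; pairing these two terms and expanding
  the \<open>n\<close>-th powers brings back \<open>u\<^sub>k\<close> or \<open>v\<^sub>k\<close>, according to the parity of \<open>r\<close>.
\<close>

lemma sum_tuples_0_eq_natpermute: "sum_tuples 0 r n = natpermute n r"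
  by (auto simp: sum_tuples_def natpermute_def)

text \<open>The factorials in the multinomial coefficient distribute over the entries, so each
  summand is \<open>fact n\<close> times a product of coefficients \<open>f k / fact k\<close>; this
  is the library's coefficient formula for a power, indexed by \<open>natpermute\<close>.\<close>

lemma sum_multinomial_eq_fps_power_nth:
  fixes f :: "nat \<Rightarrow> complex"
  shows "(\<Sum>ks\<in>sum_tuples 0 r n. multinomial n ks * prod_list (map f ks))
    = fact n * fps_nth (Abs_fps (\<lambda>k. f k / fact k) ^ r) n"
proof -
  have *: "multinomial n ks * prod_list (map f ks)
      = fact n * (\<Prod>j\<in>{0..<r}. f (ks ! j) / fact (ks ! j))"
    if "length ks = r" for ks
  proof -
    have "prod_list (map g ks) = (\<Prod>j\<in>{0..<r}. g (ks ! j))" for g :: "nat \<Rightarrow> complex"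
      using that by (simp add: prod.list_conv_set_nth)
    then show ?thesis
      by (simp add: multinomial_def prod_dividef)
  qed
  have "fps_nth (Abs_fps (\<lambda>k. f k / fact k) ^ r) n
      = (\<Sum>ks\<in>natpermute n r. \<Prod>j\<in>{0..<r}. f (ks ! j) / fact (ks ! j))"
  proof (cases r)
    case 0
    then show ?thesis by (auto simp: natpermute_0)
  next
    case (Suc m)
    then show ?thesis
      by (simp only: fps_power_nth_Suc fps_nth_Abs_fps atLeastLessThanSuc_atLeastAtMost
          flip: Suc_eq_plus1)
  qed
  then show ?thesis
    unfolding sum_tuples_0_eq_natpermute sum_distrib_left
    by (simp add: sum_distrib_left) (intro sum.cong refl, auto simp: natpermute_def *)
qed

text \<open>The parameter \<open>e\<close> treats both sequences at once: \<open>e = 1\<close> gives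
  \<open>lucas_v\<close>, and \<open>e = -1\<close> gives the numerator of
  \<open>lucas_u\<close>.\<close>

lemma sum_multinomial_sum_of_powers:
  fixes x y e :: complex
  shows "(\<Sum>ks\<in>sum_tuples 0 r n. multinomial n ks * prod_list (map (\<lambda>k. x ^ k + e * y ^ k) ks))
    = (\<Sum>j\<le>r. of_nat (r choose j) * e ^ j * (of_nat (r - j) * x + of_nat j * y) ^ n)"
proof -
  \<comment> \<open>The \<open>e\<close> summand stands first because \<open>binomial_ring\<close>
    gives the exponent \<open>j\<close> to the first summand.\<close>
  have F: "Abs_fps (\<lambda>k. (x ^ k + e * y ^ k) / fact k) = fps_const e * fps_exp y + fps_exp x"
    by (simp add: fps_eq_iff add_divide_distrib)
  have "(fps_const e * fps_exp y + fps_exp x) ^ r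
      = (\<Sum>j\<le>r. fps_const (of_nat (r choose j) * e ^ j)
          * fps_exp (of_nat (r - j) * x + of_nat j * y))"
    unfolding binomial_ring
    by (intro sum.cong refl)
      (simp add: power_mult_distrib fps_exp_power_mult fps_exp_add_mult
        fps_of_nat mult_ac flip: fps_const_mult)
  then show ?thesis
    by (simp add: sum_multinomial_eq_fps_power_nth F fps_sum_nth sum_distrib_left)
qed

text \<open>A tuple with a zero entry contributes the factor \<open>f 0 = 0\<close>. This carries
  the result for entries from 0 over to \<open>lucas_u\<close>, whose sum starts at 1.\<close>

lemma sum_multinomial_sum_tuples_1:
  assumes "f 0 = 0"
  shows "(\<Sum>ks\<in>sum_tuples 1 r n. multinomial n ks * prod_list (map f ks))
    = (\<Sum>ks\<in>sum_tuples 0 r n. multinomial n ks * prod_list (map f ks))"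
proof (rule sum.mono_neutral_left[OF finite_sum_tuples])
  show "sum_tuples 1 r n \<subseteq> sum_tuples 0 r n"
    by (auto simp: sum_tuples_def)
  show "\<forall>ks\<in>sum_tuples 0 r n - sum_tuples 1 r n. multinomial n ks * prod_list (map f ks) = 0"
  proof
    fix ks assume "ks \<in> sum_tuples 0 r n - sum_tuples 1 r n"
    then have "0 \<in> set ks"
      by (auto simp: sum_tuples_def not_le)
    then have "0 \<in> set (map f ks)"
      using assms by force
    then have "prod_list (map f ks) = 0"
      by (simp add: prod_list_zero_iff)
    then show "multinomial n ks * prod_list (map f ks) = 0"
      by simp
  qed
qed

text \<open>For odd \<open>r\<close> the reflection of \<open>j\<close> to \<open>r - j\<close> has
  no fixed point and swaps the two halves of the range.\<close>

lemma sum_atMost_odd_pair: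
  fixes h :: "nat \<Rightarrow> 'a::comm_monoid_add"
  assumes "odd r"
  shows "(\<Sum>j\<le>r. h j) = (\<Sum>j=0..(r - 1) div 2. h j + h (r - j))"
proof -
  obtain m where m: "r = 2 * m + 1" using assms by (auto elim: oddE)
  have "(\<Sum>j\<in>{m<..r}. h j) = (\<Sum>j=0..m. h (r - j))"
    by (rule sum.reindex_bij_witness[where i = "\<lambda>j. r - j" and j = "\<lambda>j. r - j"]) (auto simp: m)
  moreover have "{..r} = {0..m} \<union> {m<..r}" by (auto simp: m)
  then have "(\<Sum>j\<le>r. h j) = (\<Sum>j=0..m. h j) + (\<Sum>j\<in>{m<..r}. h j)"
    by (simp only:) (rule sum.union_disjoint, auto)
  ultimately show ?thesis
    by (simp add: m sum.distrib)
qed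

text \<open>Here the reflection fixes \<open>r div 2\<close>, which stays as a separate term. At
  \<open>r = 0\<close> truncated subtraction would leave \<open>j = 0\<close> in the range of the
  sum, hence \<open>r \<ge> 1\<close>.\<close>

lemma sum_atMost_even_pair:
  fixes h :: "nat \<Rightarrow> 'a::comm_monoid_add"
  assumes "even r" "r \<ge> 1"
  shows "(\<Sum>j\<le>r. h j) = (\<Sum>j=0..r div 2 - 1. h j + h (r - j)) + h (r div 2)"
proof -
  obtain m where m: "r = 2 * m" "m \<ge> 1" using assms by (auto elim: evenE)
  have "(\<Sum>j\<in>{m<..r}. h j) = (\<Sum>j=0..m-1. h (r - j))"
    by (rule sum.reindex_bij_witness[where i = "\<lambda>j. r - j" and j = "\<lambda>j. r - j"])
      (use m in auto)
  moreover have "{..r} = insert m ({0..m-1} \<union> {m<..r})" using m by auto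
  then have "(\<Sum>j\<le>r. h j) = h m + (\<Sum>j\<in>{0..m-1} \<union> {m<..r}. h j)"
    by (simp only:) (rule sum.insert, use m in auto)
  moreover have "(\<Sum>j\<in>{0..m-1} \<union> {m<..r}. h j) = (\<Sum>j=0..m-1. h j) + (\<Sum>j\<in>{m<..r}. h j)"
    by (rule sum.union_disjoint) auto
  ultimately show ?thesis
    by (simp add: m sum.distrib add_ac)
qed

text \<open>Since \<open>e\<close> is its own inverse, \<open>e ^ (r - j)\<close> equals
  \<open>e ^ j * e ^ r\<close>. Both terms of the pair thus share the factor \<open>e ^ j\<close>,
  and \<open>e ^ r\<close> alone fixes the sign between \<open>x ^ k\<close> and
  \<open>y ^ k\<close>.\<close>

lemma binomial_pair_expand:
  fixes x y e s :: complex and r n :: nat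
  assumes e: "e * e = 1" and s: "x + y = s" and j: "2 * j \<le> r"
  defines "h \<equiv> \<lambda>j. of_nat (r choose j) * e ^ j * (of_nat (r - j) * x + of_nat j * y) ^ n"
  shows "h j + h (r - j) = (\<Sum>k=0..n. of_nat (n choose k) * (e ^ j * of_nat (r choose j) *
    (s * of_nat j) ^ (n - k) * (of_nat r - 2 * of_nat j) ^ k * (x ^ k + e ^ r * y ^ k)))"
proof -
  let ?d = "of_nat r - 2 * of_nat j :: complex"
  have ej: "e ^ (r - j) = e ^ j * e ^ r"
  proof -
    have "e ^ j * e ^ r = (e * e) ^ j * e ^ (r - j)"
      using j by (simp add: power_mult_distrib mult.assoc flip: power_add)
    then show ?thesis using e by simp
  qed
  have expand: "(s * of_nat j + ?d * z) ^ n
      = (\<Sum>k=0..n. of_nat (n choose k) * ((s * of_nat j) ^ (n - k) * ?d ^ k * z ^ k))" for z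
    by (subst add.commute)
      (simp add: binomial_ring power_mult_distrib atLeast0AtMost mult_ac)
  \<comment> \<open>Split off \<open>j\<close> copies of \<open>x + y = s\<close>; what remains is
    \<open>r - 2 * j\<close> copies of one root.\<close>
  have z: "of_nat (r - j) * x + of_nat j * y = s * of_nat j + ?d * x"
    "of_nat (r - j) * y + of_nat j * x = s * of_nat j + ?d * y"
    using j by (simp_all add: algebra_simps flip: s)
  \<comment> \<open>Reflecting \<open>j\<close> keeps the binomial coefficient and exchanges
    \<open>x\<close> and \<open>y\<close>.\<close>
  have hr: "h (r - j) = of_nat (r choose j) * (e ^ j * e ^ r) *
      (of_nat (r - j) * y + of_nat j * x) ^ n"
    using j by (simp add: h_def ej add.commute flip: binomial_symmetric)
  have "h j + h (r - j) = of_nat (r choose j) * e ^ j *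
      ((s * of_nat j + ?d * x) ^ n + e ^ r * (s * of_nat j + ?d * y) ^ n)"
    unfolding hr z by (simp only: h_def z) (simp add: distrib_left mult_ac)
  then show ?thesis
    unfolding expand sum_distrib_left distrib_left sum.distrib by (simp add: mult_ac)
qed

lemma binomial_sum_odd:
  fixes x y e s :: complex
  assumes "e * e = 1" "x + y = s" "odd r"
  shows "(\<Sum>j\<le>r. of_nat (r choose j) * e ^ j * (of_nat (r - j) * x + of_nat j * y) ^ n)
    = (\<Sum>k=0..n. of_nat (n choose k) * (\<Sum>j=0..(r - 1) div 2. e ^ j * of_nat (r choose j) *
        (s * of_nat j) ^ (n - k) * (of_nat r - 2 * of_nat j) ^ k * (x ^ k + e ^ r * y ^ k)))"
proof -
  have "2 * j \<le> r" if "j \<in> {0..(r - 1) div 2}" for j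
    using that by auto
  then show ?thesis
    unfolding sum_atMost_odd_pair[OF assms(3)] sum_distrib_left
    by (subst sum.swap) (intro sum.cong refl binomial_pair_expand assms)
qed

text \<open>For even \<open>r\<close> the factor \<open>e ^ r\<close> is 1, so
  \<open>x ^ k + y ^ k\<close> arises for both signs of \<open>e\<close>; this is why
  \<open>lucas_v\<close> also appears in the even formula for \<open>lucas_u\<close>.\<close>

lemma binomial_sum_even:
  fixes x y e s :: complex
  assumes "e * e = 1" "x + y = s" "even r" "r \<ge> 1"
  shows "(\<Sum>j\<le>r. of_nat (r choose j) * e ^ j * (of_nat (r - j) * x + of_nat j * y) ^ n)
    = (\<Sum>k=0..n. of_nat (n choose k) * (\<Sum>j=0..r div 2 - 1. e ^ j * of_nat (r choose j) *
        (s * of_nat j) ^ (n - k) * (of_nat r - 2 * of_nat j) ^ k * (x ^ k + y ^ k)))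
      + e ^ (r div 2) * of_nat (r choose (r div 2)) * (s * of_nat r / 2) ^ n"
proof -
  have le: "2 * j \<le> r" if "j \<in> {0..r div 2 - 1}" for j
    using that by auto
  have er: "e ^ r = 1"
    using assms(1,3) by (auto elim!: evenE simp: power_mult power2_eq_square)
  have mid: "of_nat (r - r div 2) * x + of_nat (r div 2) * y = s * of_nat r / 2"
    using assms(2,3) by (auto elim!: evenE simp: algebra_simps)
  show ?thesis
    unfolding sum_atMost_even_pair[OF assms(3,4)] sum_distrib_left mid
    by (subst sum.swap)
      (intro arg_cong2[of _ _ _ _ "(+)"] sum.cong refl
        binomial_pair_expand[OF assms(1,2) le, unfolded er mult_1], auto)
qed

lemma lucas_alpha_plus_beta: "lucas_alpha a b + lucas_beta a b = of_int a"
  by (simp add: lucas_alpha_def lucas_beta_def field_simps)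

text \<open>The factor \<open>1 ^ j\<close> is kept so that the right-hand side matches the binomial
  sums above with \<open>e = 1\<close>.\<close>

lemma sum_multinomial_lucas_v:
  "(\<Sum>ks\<in>sum_tuples 0 r n. multinomial n ks * prod_list (map (lucas_v a b) ks))
    = (\<Sum>j\<le>r. of_nat (r choose j) * 1 ^ j *
        (of_nat (r - j) * lucas_alpha a b + of_nat j * lucas_beta a b) ^ n)"
  using sum_multinomial_sum_of_powers[of n "lucas_alpha a b" 1 "lucas_beta a b" r]
  by (simp add: lucas_v_def[abs_def])

lemma sum_multinomial_lucas_u:
  "(\<Sum>ks\<in>sum_tuples 1 r n. multinomial n ks * prod_list (map (lucas_u a b) ks))
    = 1 / lucas_root a b ^ r * (\<Sum>j\<le>r. of_nat (r choose j) * (-1) ^ j *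
        (of_nat (r - j) * lucas_alpha a b + of_nat j * lucas_beta a b) ^ n)"
proof -
  \<comment> \<open>Each entry contributes one denominator \<alpha> - \<beta>, which is
    \<open>lucas_root a b\<close>; tuples of length \<open>r\<close> therefore share its
    \<open>r\<close>-th power.\<close>
  have *: "prod_list (map (lucas_u a b) ks) = 1 / lucas_root a b ^ length ks *
      prod_list (map (\<lambda>k. lucas_alpha a b ^ k + (-1) * lucas_beta a b ^ k) ks)" for ks
    by (induction ks) (simp_all add: lucas_u_def lucas_alpha_minus_beta)
  show ?thesis
    unfolding sum_multinomial_sum_tuples_1[of "lucas_u a b", OF lucas_u_0]
      sum_multinomial_sum_of_powers[symmetric] sum_distrib_left
    by (intro sum.cong refl) (auto simp: * sum_tuples_def)
qed

theorem theorem6: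
  fixes a b :: int and r n :: nat
  assumes "a\<^sup>2 + 4 * b \<noteq> 0" and "r \<ge> 1"
  shows "(odd r \<longrightarrow>
      (\<Sum>ks\<in>sum_tuples 1 r n. multinomial n ks * prod_list (map (lucas_u a b) ks))
        = 1 / (csqrt (of_int (a\<^sup>2 + 4 * b))) ^ (r - 1) *
          (\<Sum>k=0..n. of_nat (n choose k) *
            (\<Sum>j=0..(r - 1) div 2. (-1) ^ j * of_nat (r choose j) *
               (of_int a * of_nat j) ^ (n - k) * (of_nat r - 2 * of_nat j) ^ k * lucas_u a b k))
      \<and>
      (\<Sum>ks\<in>sum_tuples 0 r n. multinomial n ks * prod_list (map (lucas_v a b) ks))
        = (\<Sum>k=0..n. of_nat (n choose k) *
            (\<Sum>j=0..(r - 1) div 2. of_nat (r choose j) *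
               (of_int a * of_nat j) ^ (n - k) * (of_nat r - 2 * of_nat j) ^ k * lucas_v a b k)))
    \<and> (even r \<longrightarrow>
      (\<Sum>ks\<in>sum_tuples 1 r n. multinomial n ks * prod_list (map (lucas_u a b) ks))
        = 1 / (csqrt (of_int (a\<^sup>2 + 4 * b))) ^ r *
          ((\<Sum>k=0..n. of_nat (n choose k) *
            (\<Sum>j=0..r div 2 - 1. (-1) ^ j * of_nat (r choose j) *
               (of_int a * of_nat j) ^ (n - k) * (of_nat r - 2 * of_nat j) ^ k * lucas_v a b k))
           + (-1) ^ (r div 2) * of_nat (r choose (r div 2)) * (of_int a * of_nat r / 2) ^ n)
      \<and>
      (\<Sum>ks\<in>sum_tuples 0 r n. multinomial n ks * prod_list (map (lucas_v a b) ks))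
        = (\<Sum>k=0..n. of_nat (n choose k) *
            (\<Sum>j=0..r div 2 - 1. of_nat (r choose j) *
               (of_int a * of_nat j) ^ (n - k) * (of_nat r - 2 * of_nat j) ^ k * lucas_v a b k))
          + of_nat (r choose (r div 2)) * (of_int a * of_nat r / 2) ^ n)"
proof -
  let ?x = "lucas_alpha a b" and ?y = "lucas_beta a b" and ?d = "lucas_root a b"
  have "(of_int (a\<^sup>2 + 4 * b) :: complex) \<noteq> 0"
    using assms(1) of_int_eq_0_iff by blast
  then have d: "?d \<noteq> 0"
    using lucas_root_squared[of a b] by auto
  have u: "?x ^ k + (-1) ^ r * ?y ^ k = ?d * lucas_u a b k" if "odd r" for k
    using that d by (simp add: lucas_u_def lucas_alpha_minus_beta)
  \<comment> \<open>For odd \<open>r\<close> the difference of \<open>k\<close>-th powers is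
    \<open>?d * lucas_u a b k\<close>, and this factor \<open>?d\<close> lowers the exponent in the
    denominator to \<open>r - 1\<close>.\<close>
  have cancel: "1 / ?d ^ r * (\<Sum>k=0..n. of_nat (n choose k) * (\<Sum>j=0..m. A j k * (?d * lucas_u a b k)))
      = 1 / ?d ^ (r - 1) * (\<Sum>k=0..n. of_nat (n choose k) * (\<Sum>j=0..m. A j k * lucas_u a b k))"
    for A :: "nat \<Rightarrow> nat \<Rightarrow> complex" and m
  proof -
    have "(\<Sum>k=0..n. of_nat (n choose k) * (\<Sum>j=0..m. A j k * (?d * lucas_u a b k)))
        = ?d * (\<Sum>k=0..n. of_nat (n choose k) * (\<Sum>j=0..m. A j k * lucas_u a b k))"
      by (simp add: sum_distrib_left mult_ac)
    moreover have "?d ^ r = ?d * ?d ^ (r - 1)"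
      using assms(2) by (cases r) auto
    ultimately show ?thesis
      using d by simp
  qed
  note odd = binomial_sum_odd[OF _ lucas_alpha_plus_beta]
    and even = binomial_sum_even[OF _ lucas_alpha_plus_beta _ assms(2)]
  show ?thesis
    unfolding sum_multinomial_lucas_u sum_multinomial_lucas_v lucas_root_def[symmetric]
  proof (intro conjI impI)
    assume r: "odd r"
    show "1 / ?d ^ r * (\<Sum>j\<le>r. of_nat (r choose j) * (-1) ^ j *
          (of_nat (r - j) * ?x + of_nat j * ?y) ^ n)
        = 1 / ?d ^ (r - 1) * (\<Sum>k=0..n. of_nat (n choose k) *
            (\<Sum>j=0..(r - 1) div 2. (-1) ^ j * of_nat (r choose j) *
               (of_int a * of_nat j) ^ (n - k) * (of_nat r - 2 * of_nat j) ^ k * lucas_u a b k))"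
      by (subst odd, simp, rule r, simp only: u[OF r] cancel)
  \<comment> \<open>The three remaining identities all end in \<open>lucas_v\<close>: the odd one
    with \<open>e = 1\<close>, and the even ones with \<open>e = -1\<close> and
    \<open>e = 1\<close>.\<close>
  qed (subst odd even; simp add: lucas_v_def)+
qed

end
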